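(* Let $G$ be a finite simple graph, let $c:E(G)\to\{1,\dots,k\}$ be a colouring of its edges (giving the edge-coloured graph $G^c$), and let $f:V(G)\to\mathbb{N}$ be a function with $f(v)\le d^c(v)$ for every $v\in V(G)$. Then $G^c$ has a properly coloured $f$-factor if and only if, for every palette system $\mathcal{S}=(S,T,W)$ of $G^c$, we have $\mathrm{odd}(G^c_f-X_{\mathcal{S}})\le |X_{\mathcal{S}}|$.
   Context: $\mathbb{N}$ includes $0$. For a graph $H$, $\mathrm{odd}(H)$ is the number of connected components of $H$ with an odd number of vertices; $H-X$ denotes deletion of the vertex set $X$. An $f$-factor of $G$ is a spanning subgraph $F$ with $d_F(v)=f(v)$ for all $v$; it is properly coloured (a pc-$f$-factor) if any two edges of $F$ sharing an endpoint have different colours. For $u\in V(G)$, $E^c(u)$ is the set of colours of edges incident with $u$ and $d^c(u)=|E^c(u)|$ is its colour degree. The graph $G^c_f$: replace each vertex $u$ of $G$ by a complete bipartite graph with parts $S_u=\{u_i : i\in E^c(u)\}$ and $T_u=\{u'_i : 1\le i\le d^c(u)-f(u)\}$, and for every edge $uv$ of $G$ with $c(uv)=j$ add the edge $u_jv_j$. Let $\hat f=\max_v f(v)$, $\mathcal{C}_0=\bigcup_{0\le i\le \hat f-2}\binom{\{1,\dots,k\}}{i}$ and $\mathcal{C}_1=\bigcup_{1\le i\le \hat f-1}\binom{\{1,\dots,k\}}{i}$ (families of subsets of the colour set of the given sizes). A palette system of $G^c$ is a triple $(S,T,W)$ of pairwise disjoint subsets of $V(G)$ where $T=\bigcup_{A\in\mathcal{C}_0}T^A$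 is a union of pairwise disjoint sets $T^A\subseteq V(G)$ indexed by $A\in\mathcal{C}_0$, and $W=\bigcup_{A\in\mathcal{C}_1}W^A$ is a union of pairwise disjoint sets $W^A\subseteq V(G)$ indexed by $A\in\mathcal{C}_1$. Define $X_S=\bigcup_{u\in S}S_u$, $X_T=\bigcup_{A\in\mathcal{C}_0}\bigcup_{u\in T^A}(T_u\cup\{u_i: i\in A\})$, $X_W=\bigcup_{A\in\mathcal{C}_1}\bigcup_{u\in W^A}\{u_i: i\in A\}$ (here $u_i$ denotes the vertex of $S_u$, present only for $i\in E^c(u)$), and $X_{\mathcal{S}}=X_S\cup X_T\cup X_W\subseteq V(G^c_f)$. *)

theory Defs
  imports Main "HOL-Library.Disjoint_Sets"
begin

record 'v ugraph =
  verts :: "'v set"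
  edges :: "'v set set"

definition finite_simple_graph :: "'v ugraph \<Rightarrow> bool" where
  "finite_simple_graph G \<longleftrightarrow>
     finite (verts G) \<and> (\<forall>e\<in>edges G. e \<subseteq> verts G \<and> card e = 2)"

definition degree :: "'v ugraph \<Rightarrow> 'v \<Rightarrow> nat" where
  "degree G v = card {e \<in> edges G. v \<in> e}"

definition delete_verts :: "'v ugraph \<Rightarrow> 'v set \<Rightarrow> 'v ugraph" where
  "delete_verts H X = \<lparr>verts = verts H - X, edges = {e \<in> edges H. e \<inter> X = {}}\<rparr>"

definition adjacency :: "'v ugraph \<Rightarrow> 'v rel" where
  "adjacency H = {(u, v). u \<in> verts H \<and> v \<in> verts H \<and> {u, v} \<in> edges H}"

definition conn_components :: "'v ugraph \<Rightarrow> 'v set set" where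
  "conn_components H = verts H // Restr ((adjacency H)\<^sup>*) (verts H)"

definition odd_components :: "'v ugraph \<Rightarrow> nat" where
  "odd_components H = card {C \<in> conn_components H. odd (card C)}"

definition f_factor :: "'v ugraph \<Rightarrow> ('v \<Rightarrow> nat) \<Rightarrow> 'v ugraph \<Rightarrow> bool" where
  "f_factor G f F \<longleftrightarrow>
     verts F = verts G \<and> edges F \<subseteq> edges G \<and> (\<forall>v\<in>verts G. degree F v = f v)"

definition properly_coloured :: "('v set \<Rightarrow> nat) \<Rightarrow> 'v ugraph \<Rightarrow> bool" where
  "properly_coloured c F \<longleftrightarrow>
     (\<forall>e\<in>edges F. \<forall>e'\<in>edges F. e \<noteq> e' \<and> e \<inter> e' \<noteq> {} \<longrightarrow> c e \<noteq> c e')"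

definition pc_f_factor ::
    "'v ugraph \<Rightarrow> ('v set \<Rightarrow> nat) \<Rightarrow> ('v \<Rightarrow> nat) \<Rightarrow> 'v ugraph \<Rightarrow> bool" where
  "pc_f_factor G c f F \<longleftrightarrow> f_factor G f F \<and> properly_coloured c F"

definition colours_at :: "'v ugraph \<Rightarrow> ('v set \<Rightarrow> nat) \<Rightarrow> 'v \<Rightarrow> nat set" where
  "colours_at G c u = c ` {e \<in> edges G. u \<in> e}"

definition colour_degree :: "'v ugraph \<Rightarrow> ('v set \<Rightarrow> nat) \<Rightarrow> 'v \<Rightarrow> nat" where
  "colour_degree G c u = card (colours_at G c u)"

text \<open>\<open>SV u i\<close> is the vertex \<open>u\<^sub>i\<close> and \<open>TV u i\<close> is the vertex \<open>u'\<^sub>i\<close> of the graph \<open>G\<^sup>c\<^sub>f\<close>.\<close>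

datatype 'v gvert = SV 'v nat | TV 'v nat

definition S_part :: "'v ugraph \<Rightarrow> ('v set \<Rightarrow> nat) \<Rightarrow> 'v \<Rightarrow> 'v gvert set" where
  "S_part G c u = {SV u i | i. i \<in> colours_at G c u}"

definition T_part ::
    "'v ugraph \<Rightarrow> ('v set \<Rightarrow> nat) \<Rightarrow> ('v \<Rightarrow> nat) \<Rightarrow> 'v \<Rightarrow> 'v gvert set" where
  "T_part G c f u = {TV u i | i. 1 \<le> i \<and> i \<le> colour_degree G c u - f u}"

definition Gcf ::
    "'v ugraph \<Rightarrow> ('v set \<Rightarrow> nat) \<Rightarrow> ('v \<Rightarrow> nat) \<Rightarrow> 'v gvert ugraph" where
  "Gcf G c f = \<lparr>
     verts = (\<Union>u\<in>verts G. S_part G c u \<union> T_part G c f u),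
     edges = (\<Union>u\<in>verts G. {{x, y} | x y. x \<in> S_part G c u \<and> y \<in> T_part G c f u})
           \<union> {{SV u (c {u, v}), SV v (c {u, v})} | u v. {u, v} \<in> edges G}\<rparr>"

text \<open>If \<open>G\<close> has no vertices, \<open>f_max\<close> is unspecified; this is harmless, since then all sets of
  a palette system are empty.\<close>

definition f_max :: "'v ugraph \<Rightarrow> ('v \<Rightarrow> nat) \<Rightarrow> nat" where
  "f_max G f = Max (f ` verts G)"

text \<open>The upper bounds \<open>f_max - 2\<close> and \<open>f_max - 1\<close> on the cardinalities are meant in the integers
  (the family is empty if the bound is too small), hence the additive form.\<close>

definition C0 :: "'v ugraph \<Rightarrow> nat \<Rightarrow> ('v \<Rightarrow> nat) \<Rightarrow> nat set set" where
  "C0 G k f = {A. A \<subseteq> {1..k} \<and> card A + 2 \<le> f_max G f}"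

definition C1 :: "'v ugraph \<Rightarrow> nat \<Rightarrow> ('v \<Rightarrow> nat) \<Rightarrow> nat set set" where
  "C1 G k f = {A. A \<subseteq> {1..k} \<and> 1 \<le> card A \<and> card A + 1 \<le> f_max G f}"

text \<open>The components \<open>T\<close> and \<open>W\<close> are given by their families \<open>A \<mapsto> T\<^sup>A\<close> and \<open>A \<mapsto> W\<^sup>A\<close>, of
  which only the members with index in \<open>C0\<close>, respectively \<open>C1\<close>, are relevant.\<close>

definition palette_system ::
    "'v ugraph \<Rightarrow> nat \<Rightarrow> ('v \<Rightarrow> nat) \<Rightarrow>
      'v set \<Rightarrow> (nat set \<Rightarrow> 'v set) \<Rightarrow> (nat set \<Rightarrow> 'v set) \<Rightarrow> bool" where
  "palette_system G k f S T W \<longleftrightarrow>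
     S \<subseteq> verts G \<and>
     (\<forall>A\<in>C0 G k f. T A \<subseteq> verts G) \<and> disjoint_family_on T (C0 G k f) \<and>
     (\<forall>A\<in>C1 G k f. W A \<subseteq> verts G) \<and> disjoint_family_on W (C1 G k f) \<and>
     S \<inter> (\<Union>A\<in>C0 G k f. T A) = {} \<and>
     S \<inter> (\<Union>A\<in>C1 G k f. W A) = {} \<and>
     (\<Union>A\<in>C0 G k f. T A) \<inter> (\<Union>A\<in>C1 G k f. W A) = {}"

definition X_S :: "'v ugraph \<Rightarrow> ('v set \<Rightarrow> nat) \<Rightarrow> 'v set \<Rightarrow> 'v gvert set" where
  "X_S G c S = (\<Union>u\<in>S. S_part G c u)"

definition X_T ::
    "'v ugraph \<Rightarrow> nat \<Rightarrow> ('v set \<Rightarrow> nat) \<Rightarrow> ('v \<Rightarrow> nat) \<Rightarrow> (nat set \<Rightarrow> 'v set) \<Rightarrow> 'v gvert set" where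
  "X_T G k c f T =
     (\<Union>A\<in>C0 G k f. \<Union>u\<in>T A. T_part G c f u \<union> {SV u i | i. i \<in> A \<inter> colours_at G c u})"

definition X_W ::
    "'v ugraph \<Rightarrow> nat \<Rightarrow> ('v set \<Rightarrow> nat) \<Rightarrow> ('v \<Rightarrow> nat) \<Rightarrow> (nat set \<Rightarrow> 'v set) \<Rightarrow> 'v gvert set" where
  "X_W G k c f W =
     (\<Union>A\<in>C1 G k f. \<Union>u\<in>W A. {SV u i | i. i \<in> A \<inter> colours_at G c u})"

definition X_palette ::
    "'v ugraph \<Rightarrow> nat \<Rightarrow> ('v set \<Rightarrow> nat) \<Rightarrow> ('v \<Rightarrow> nat) \<Rightarrow>
      'v set \<Rightarrow> (nat set \<Rightarrow> 'v set) \<Rightarrow> (nat set \<Rightarrow> 'v set) \<Rightarrow> 'v gvert set" where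
  "X_palette G k c f S T W = X_S G c S \<union> X_T G k c f T \<union> X_W G k c f W"

end

theory Submission imports Defs begin

text \<open>
  A properly coloured \<open>f\<close>-factor of \<open>G\<close> is the same as a perfect matching of \<open>G\<^sup>c\<^sub>f\<close>: the vertices
  \<open>T\<^sub>u\<close> absorb all but \<open>f u\<close> of the colours at \<open>u\<close>. By Tutte's theorem it remains to turn a set \<open>X\<close> with
  \<open>odd (G\<^sup>c\<^sub>f - X) > |X|\<close> into one of palette form. If \<open>G\<^sup>c\<^sub>f\<close> has odd order, the empty set works.
  Otherwise the two sides have the same parity, so there is slack 2, and \<open>X\<close> can be modified on one
  gadget at a time. Unless \<open>T\<^sub>u \<subseteq> X\<close> and \<open>|S\<^sub>u \<inter> X| \<le> f u - 2\<close>, removing the vertices of \<open>T\<^sub>u\<close> from \<open>X\<close> merges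
  so few components that \<open>X\<close> still violates Tutte's condition. If then \<open>|S\<^sub>u \<inter> X| \<ge> f u\<close>, adding the
  rest of \<open>S\<^sub>u\<close> destroys one component and isolates the \<open>d\<^sup>c u - f u\<close> vertices of \<open>T\<^sub>u\<close>.
\<close>

section \<open>Components\<close>

text \<open>Edges and vertices are separate arguments, so that deleting vertices changes
  \<open>V\<close> only; edges with an end outside \<open>V\<close> are ignored.\<close>

definition comps :: "'a set set \<Rightarrow> 'a set \<Rightarrow> 'a set set" where
  "comps E V = conn_components \<lparr>verts = V, edges = E\<rparr>"

definition odd_comps :: "'a set set \<Rightarrow> 'a set \<Rightarrow> 'a set set" where
  "odd_comps E V = {C \<in> comps E V. odd (card C)}"

text \<open>The family \<open>E\<close> is arbitrary in the general part, so the size of the edges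
  is demanded of the matching itself.\<close>

definition perfect_matching :: "'a set set \<Rightarrow> 'a set \<Rightarrow> 'a set set \<Rightarrow> bool" where
  "perfect_matching E V M \<longleftrightarrow>
     M \<subseteq> E \<and> (\<forall>e\<in>M. card e = 2) \<and> disjoint M \<and> \<Union>M = V"

definition adj :: "'a set set \<Rightarrow> 'a set \<Rightarrow> 'a rel" where
  "adj E V = {(u, v). u \<in> V \<and> v \<in> V \<and> {u, v} \<in> E}"

text \<open>Adjacency on the remaining vertices never sees an edge that meets \<open>X\<close>, so
  the full edge set can be kept.\<close>

lemma odd_components_delete_verts:
  "odd_components (delete_verts H X) = card (odd_comps (edges H) (verts H - X))"
proof -
  have "adjacency (delete_verts H X) = adjacency \<lparr>verts = verts H - X, edges = edges H\<rparr>"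
    by (auto simp: adjacency_def delete_verts_def)
  then have "conn_components (delete_verts H X) = comps (edges H) (verts H - X)"
    by (simp add: conn_components_def comps_def delete_verts_def)
  then show ?thesis
    by (simp add: odd_components_def odd_comps_def)
qed

lemma sym_adj: "sym ((adj E V)\<^sup>*)"
  by (rule sym_rtrancl) (auto simp: sym_def adj_def insert_commute)

lemma comps_eq: "comps E V = V // Restr ((adj E V)\<^sup>*) V"
  by (simp add: comps_def conn_components_def adjacency_def adj_def)

lemma equiv_adj: "equiv V (Restr ((adj E V)\<^sup>*) V)"
proof (rule equivI)
  show "refl_on V (Restr ((adj E V)\<^sup>*) V)"
    by (auto simp: refl_on_def)
  show "sym (Restr ((adj E V)\<^sup>*) V)"
    using sym_adj[of E V] by (auto simp: sym_def)
  show "trans (Restr ((adj E V)\<^sup>*) V)"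
    by (intro trans_Restr trans_rtrancl)
qed auto

lemma Union_comps: "\<Union>(comps E V) = V"
  unfolding comps_eq by (rule Union_quotient[OF equiv_adj])

lemma comps_disjoint: "disjoint (comps E V)"
  unfolding comps_eq disjoint_def using quotient_disj[OF equiv_adj] by blast

lemma comps_unique:
  assumes "C \<in> comps E V" "D \<in> comps E V" "x \<in> C" "x \<in> D"
  shows "C = D"
  using assms comps_disjoint[of E V] by (auto simp: disjoint_def)

lemma comps_subset: "C \<in> comps E V \<Longrightarrow> C \<subseteq> V"
  using Union_comps[of E V] by blast

lemma comps_nonempty: "C \<in> comps E V \<Longrightarrow> C \<noteq> {}"
  unfolding comps_eq using in_quotient_imp_non_empty[OF equiv_adj] by blast

lemma finite_comps: "finite V \<Longrightarrow> finite (comps E V)"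
  using Union_comps[of E V] by (simp add: finite_UnionD)

lemma finite_odd_comps: "finite V \<Longrightarrow> finite (odd_comps E V)"
  by (simp add: odd_comps_def finite_comps)

lemma comps_closed:
  assumes "C \<in> comps E V" "x \<in> C" "y \<in> V" "{x, y} \<in> E"
  shows "y \<in> C"
proof -
  have "(x, y) \<in> Restr ((adj E V)\<^sup>*) V"
    using assms comps_subset[OF assms(1)] by (auto simp: adj_def)
  then show ?thesis
    using assms(1,2) in_quotient_imp_closed[OF equiv_adj] unfolding comps_eq by metis
qed

lemma comps_eq_image:
  assumes "C \<in> comps E V" "v \<in> C"
  shows "C = (adj E V)\<^sup>* `` {v}"
proof -
  have v: "v \<in> V"
    using assms comps_subset by blast
  then have "Restr ((adj E V)\<^sup>*) V `` {v} \<in> comps E V"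
    unfolding comps_eq by (rule quotientI)
  then have "C = Restr ((adj E V)\<^sup>*) V `` {v}"
    using assms v by (intro comps_unique[of _ E V _ v]) auto
  moreover have "w \<in> V" if "(v, w) \<in> (adj E V)\<^sup>*" for w
    using that v by (induction rule: rtrancl_induct) (auto simp: adj_def)
  ultimately show ?thesis
    using v by auto
qed

text \<open>A component is determined by the walks from one of its vertices. Those in
  \<open>V\<close> stay in \<open>C\<close> and hence exist in \<open>U\<close>; closedness keeps
  those in \<open>U\<close> inside \<open>C\<close>.\<close>

lemma comps_transfer:
  assumes C: "C \<in> comps E V" "C \<subseteq> U"
    and closed: "\<And>x y. \<lbrakk>x \<in> C; y \<in> U; {x, y} \<in> E\<rbrakk> \<Longrightarrow> y \<in> C"
  shows "C \<in> comps E U"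
proof -
  obtain v where v: "v \<in> C"
    using comps_nonempty[OF C(1)] by blast
  have CV: "C = (adj E V)\<^sup>* `` {v}"
    using comps_eq_image[OF C(1) v] .
  have 1: "w \<in> C" if "(v, w) \<in> (adj E U)\<^sup>*" for w
    using that v by (induction rule: rtrancl_induct) (auto simp: adj_def intro: closed)
  have 2: "(v, w) \<in> (adj E U)\<^sup>*" if "(v, w) \<in> (adj E V)\<^sup>*" for w
    using that
  proof (induction rule: rtrancl_induct)
    case (step y z)
    then have "y \<in> C" "z \<in> C"
      using CV by auto
    then have "(y, z) \<in> adj E U"
      using step(2) C(2) by (auto simp: adj_def)
    then show ?case
      using step(3) by simp
  qed simp
  have "C = Restr ((adj E U)\<^sup>*) U `` {v}"
    using 1 2 CV v C(2) by auto
  then show ?thesis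
    using v C(2) unfolding comps_eq by (auto intro: quotientI)
qed

lemma singleton_comps:
  assumes "x \<in> V" "\<And>y. \<lbrakk>y \<in> V; {x, y} \<in> E\<rbrakk> \<Longrightarrow> y = x"
  shows "{x} \<in> comps E V"
proof -
  \<comment> \<open>On the vertex set \<open>{x}\<close> the only component is \<open>{x}\<close>,
    and it is transferred to \<open>V\<close>.\<close>
  obtain C where C: "C \<in> comps E {x}" "x \<in> C"
    using Union_comps[of E "{x}"] by (metis UnionE insertI1)
  then have "C = {x}"
    using comps_subset[OF C(1)] by blast
  with C(1) have "{x} \<in> comps E {x}"
    by simp
  then show ?thesis
    by (rule comps_transfer) (use assms in auto)
qed

section \<open>Parity and refinement of components\<close>

text \<open>The orders of the components add up to \<open>card V\<close>, and only the odd ones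
  count modulo 2.\<close>

lemma odd_comps_parity:
  assumes "finite V"
  shows "even (card (odd_comps E V)) \<longleftrightarrow> even (card V)"
proof -
  have "card V = (\<Sum>C\<in>comps E V. card C)"
    using card_Union_disjoint[of "comps E V"] comps_disjoint[of E V] Union_comps[of E V]
      comps_subset[of _ E V] finite_subset[OF _ assms] by metis
  then show ?thesis
    using even_sum_iff[OF finite_comps[OF assms], of card E] by (simp add: odd_comps_def)
qed

lemma odd_comps_parity_diff:
  assumes "finite V" "X \<subseteq> V"
  shows "even (card (odd_comps E (V - X)) + card X) \<longleftrightarrow> even (card V)"
proof -
  have "card V = card (V - X) + card X"
    using assms by (metis add.commute card_Diff_subset card_mono finite_subset le_add_diff_inverse)
  then show ?thesis
    using odd_comps_parity[of "V - X" E] assms by auto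
qed

text \<open>No edge joins \<open>C\<close> to the rest of \<open>V\<close>, so deleting
  \<open>Y\<close> splits \<open>C\<close> alone and its pieces stay separate from the other
  components.\<close>

lemma comps_refine:
  assumes C: "C \<in> comps E V" "Y \<subseteq> C"
  shows "comps E V - {C} \<subseteq> comps E (V - Y)" and "comps E (C - Y) \<subseteq> comps E (V - Y)"
proof
  fix D assume D: "D \<in> comps E V - {C}"
  then have "C \<inter> D = {}"
    using comps_unique[OF C(1), of D] by blast
  then have "D \<subseteq> V - Y"
    using D C(2) comps_subset[of D E V] by blast
  then show "D \<in> comps E (V - Y)"
    using comps_transfer[of D E V "V - Y"] comps_closed[of D E V] D by blast
next
  show "comps E (C - Y) \<subseteq> comps E (V - Y)"
  proof
    fix D assume D: "D \<in> comps E (C - Y)"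
    then have sub: "D \<subseteq> C - Y"
      by (rule comps_subset)
    show "D \<in> comps E (V - Y)"
    proof (rule comps_transfer[OF D])
      show "D \<subseteq> V - Y"
        using sub comps_subset[OF C(1)] by blast
    next
      fix x y assume "x \<in> D" "y \<in> V - Y" "{x, y} \<in> E"
      moreover from this have "y \<in> C"
        using sub comps_closed[OF C(1), of x y] by blast
      ultimately show "y \<in> D"
        using comps_closed[OF D, of x y] by blast
    qed
  qed
qed

text \<open>The set \<open>C\<close> is discounted because it may itself be odd; the two families on
  the left are disjoint.\<close>

lemma card_odd_comps_refine:
  assumes "finite V" and C: "C \<in> comps E V" "Y \<subseteq> C"
  shows "card (odd_comps E V - {C}) + card (odd_comps E (C - Y)) \<le> card (odd_comps E (V - Y))"
proof -
  have fin: "finite C"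
    using comps_subset[OF C(1)] assms(1) finite_subset by blast
  have "(odd_comps E V - {C}) \<inter> odd_comps E (C - Y) = {}"
  proof (rule ccontr)
    assume "(odd_comps E V - {C}) \<inter> odd_comps E (C - Y) \<noteq> {}"
    then obtain D where D: "D \<in> comps E V" "D \<noteq> C" "D \<in> comps E (C - Y)"
      by (auto simp: odd_comps_def)
    then obtain x where "x \<in> D" "x \<in> C"
      using comps_subset[OF D(3)] comps_nonempty[OF D(3)] by blast
    then show False
      using comps_unique[OF C(1) D(1)] D(2) by blast
  qed
  then have "card (odd_comps E V - {C}) + card (odd_comps E (C - Y)) =
      card ((odd_comps E V - {C}) \<union> odd_comps E (C - Y))"
    using fin assms(1) by (simp add: card_Un_disjoint finite_odd_comps)
  also have "\<dots> \<le> card (odd_comps E (V - Y))"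
    using comps_refine[OF C] assms(1)
    by (intro card_mono) (auto simp: finite_comps odd_comps_def)
  finally show ?thesis .
qed

section \<open>The theorems of Hall and Tutte\<close>

text \<open>Induction in the style of Halmos and Vaughan: either some proper nonempty subfamily is
  tight and the problem splits, or every such subfamily has an element to spare and the first choice
  is free.\<close>

theorem hall:
  assumes "finite I" "\<And>i. i \<in> I \<Longrightarrow> finite (A i)"
    and "\<And>J. J \<subseteq> I \<Longrightarrow> card J \<le> card (\<Union>(A ` J))"
  shows "\<exists>r. inj_on r I \<and> (\<forall>i\<in>I. r i \<in> A i)"
  using assms
proof (induction "card I" arbitrary: I A rule: less_induct)
  case less
  note fin = less.prems(1) and finA = less.prems(2) and hall = less.prems(3)
  show ?case
  proof (cases "\<exists>J. J \<subset> I \<and> J \<noteq> {} \<and> card (\<Union>(A ` J)) = card J")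
    case True
    then obtain J where J: "J \<subset> I" "J \<noteq> {}" "card (\<Union>(A ` J)) = card J"
      by blast
    define U where "U = \<Union>(A ` J)"
    have finJ: "finite J"
      using J fin finite_subset by blast
    have finU: "finite U"
      unfolding U_def using finJ finA J(1) by auto
    have "\<exists>r. inj_on r J \<and> (\<forall>i\<in>J. r i \<in> A i)"
    proof (rule less.hyps)
      show "card J < card I"
        using J(1) fin by (rule psubset_card_mono[rotated])
      show "finite J" "\<And>i. i \<in> J \<Longrightarrow> finite (A i)"
        using finJ finA J(1) by auto
      show "\<And>K. K \<subseteq> J \<Longrightarrow> card K \<le> card (\<Union>(A ` K))"
        using hall J(1) by (meson order_trans psubset_imp_subset)
    qed
    then obtain r where r: "inj_on r J" "\<forall>i\<in>J. r i \<in> A i"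
      by blast
    \<comment> \<open>Hall's condition survives the removal of \<open>U\<close>: it is applied to
      \<open>K\<close> together with \<open>J\<close>, and \<open>J\<close> accounts for exactly
      \<open>card U\<close> elements.\<close>
    have "\<exists>s. inj_on s (I - J) \<and> (\<forall>i\<in>I - J. s i \<in> A i - U)"
    proof (rule less.hyps)
      show "card (I - J) < card I"
        using J fin by (intro psubset_card_mono) auto
      show "finite (I - J)" "\<And>i. i \<in> I - J \<Longrightarrow> finite (A i - U)"
        using fin finA by auto
      fix K assume K: "K \<subseteq> I - J"
      have finK: "finite K"
        using K fin finite_subset by blast
      have "card K + card J = card (K \<union> J)"
        using K finK finJ by (subst card_Un_disjoint) auto
      also have "\<dots> \<le> card (\<Union>(A ` (K \<union> J)))"
        using K J(1) by (intro hall) auto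
      also have "\<Union>(A ` (K \<union> J)) = (\<Union>i\<in>K. A i - U) \<union> U"
        by (auto simp: U_def)
      also have "card \<dots> \<le> card (\<Union>i\<in>K. A i - U) + card U"
        by (rule card_Un_le)
      finally show "card K \<le> card (\<Union>i\<in>K. A i - U)"
        using J(3) by (simp add: U_def)
    qed
    then obtain s where s: "inj_on s (I - J)" "\<forall>i\<in>I - J. s i \<in> A i - U"
      by blast
    define t where "t i = (if i \<in> J then r i else s i)" for i
    have "inj_on t (J \<union> (I - J))"
      unfolding inj_on_Un
    proof (intro conjI)
      show "inj_on t J" "inj_on t (I - J)"
        using r(1) s(1) by (auto simp: t_def inj_on_def)
      show "t ` (J - (I - J)) \<inter> t ` (I - J - J) = {}"
        using r(2) s(2) by (auto simp: t_def U_def)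
    qed
    moreover have "J \<union> (I - J) = I"
      using J(1) by blast
    moreover have "\<forall>i\<in>I. t i \<in> A i"
      using r s by (auto simp: t_def)
    ultimately show ?thesis
      by auto
  next
    case slack: False
    show ?thesis
    proof (cases "I = {}")
      case False
      then obtain i where i: "i \<in> I"
        by blast
      have "card {i} \<le> card (A i)"
        using hall[of "{i}"] i by simp
      then obtain a where a: "a \<in> A i"
        by fastforce
      \<comment> \<open>Without tight subfamilies, each union can afford to lose the one element
        \<open>a\<close>.\<close>
      have "\<exists>s. inj_on s (I - {i}) \<and> (\<forall>j\<in>I - {i}. s j \<in> A j - {a})"
      proof (rule less.hyps)
        show "card (I - {i}) < card I"
          using i fin by (rule card_Diff1_less[rotated])
        show "finite (I - {i})" "\<And>j. j \<in> I - {i} \<Longrightarrow> finite (A j - {a})"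
          using fin finA by auto
        fix K assume K: "K \<subseteq> I - {i}"
        show "card K \<le> card (\<Union>j\<in>K. A j - {a})"
        proof (cases "K = {}")
          case False
          have "card K \<le> card (\<Union>(A ` K))"
            using K by (intro hall) auto
          moreover have "K \<subset> I"
            using K i by blast
          ultimately have "card K < card (\<Union>(A ` K))"
            using slack False by (metis le_neq_implies_less)
          moreover have "card (\<Union>(A ` K)) - 1 \<le> card (\<Union>(A ` K) - {a})"
            by (cases "a \<in> \<Union>(A ` K)") (auto simp: card_Diff_singleton_if)
          moreover have "(\<Union>j\<in>K. A j - {a}) = \<Union>(A ` K) - {a}"
            by blast
          ultimately show ?thesis
            by (simp only:)
        qed simp
      qed
      then obtain s where s: "inj_on s (I - {i})" "\<forall>j\<in>I - {i}. s j \<in> A j - {a}"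
        by blast
      have "inj_on (s(i := a)) I" "\<forall>j\<in>I. (s(i := a)) j \<in> A j"
        using s a by (auto simp: inj_on_def)
      then show ?thesis
        by blast
    qed simp
  qed
qed

section \<open>Perfect matchings and Tutte's theorem\<close>

lemma perfect_matching_insert:
  assumes "perfect_matching E V M" "{x, y} \<in> E" "x \<noteq> y" "x \<notin> V" "y \<notin> V"
  shows "perfect_matching E (insert x (insert y V)) (insert {x, y} M)"
proof -
  have "e \<inter> {x, y} = {}" if "e \<in> M" for e
    using assms that unfolding perfect_matching_def by blast
  then have "disjoint (insert {x, y} M)"
    using assms(1) by (auto simp: perfect_matching_def disjoint_def)
  then show ?thesis
    using assms by (simp add: perfect_matching_def)
qed

lemma perfect_matching_UN:
  assumes pm: "\<And>i. i \<in> I \<Longrightarrow> perfect_matching E (V i) (M i)"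
    and disj: "disjoint_family_on V I"
  shows "perfect_matching E (\<Union>i\<in>I. V i) (\<Union>i\<in>I. M i)"
proof -
  have "e \<inter> e' = {}" if "i \<in> I" "j \<in> I" "e \<in> M i" "e' \<in> M j" "e \<noteq> e'" for i j e e'
  proof (cases "i = j")
    case True
    then show ?thesis
      using pm[OF that(1)] that by (auto simp: perfect_matching_def disjoint_def)
  next
    case False
    then have "V i \<inter> V j = {}"
      using disj that by (simp add: disjoint_family_on_def)
    moreover have "e \<subseteq> V i" "e' \<subseteq> V j"
      using pm that unfolding perfect_matching_def by blast+
    ultimately show ?thesis
      by blast
  qed
  then have "disjoint (\<Union>i\<in>I. M i)"
    unfolding disjoint_def by (metis UN_E)
  moreover have "(\<Union>i\<in>I. V i) = (\<Union>i\<in>I. \<Union>(M i))"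
    using pm by (intro SUP_cong) (auto simp: perfect_matching_def)
  then have "\<Union>(\<Union>i\<in>I. M i) = (\<Union>i\<in>I. V i)"
    by (simp only:) blast
  moreover have "M i \<subseteq> E" "\<forall>e\<in>M i. card e = 2" if "i \<in> I" for i
    using pm[OF that] by (auto simp: perfect_matching_def)
  ultimately show ?thesis
    unfolding perfect_matching_def by (metis UN_E UN_least)
qed

lemma perfect_matching_imp_odd_comps_le:
  assumes "finite V" "X \<subseteq> V" "perfect_matching E V M"
  shows "card (odd_comps E (V - X)) \<le> card X"
proof -
  have M: "M \<subseteq> E" "\<And>e. e \<in> M \<Longrightarrow> card e = 2" "disjoint M" "\<Union>M = V"
    using assms(3) by (auto simp: perfect_matching_def)
  \<comment> \<open>Otherwise \<open>M\<close> pairs the vertices of \<open>C\<close> among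
    themselves, and \<open>card C\<close> is even.\<close>
  have ex: "\<exists>x\<in>X. \<exists>y\<in>C. {x, y} \<in> M" if C: "C \<in> odd_comps E (V - X)" for C
  proof (rule ccontr)
    assume no: "\<not> ?thesis"
    have Cc: "C \<in> comps E (V - X)" "odd (card C)"
      using C by (auto simp: odd_comps_def)
    have sub: "C \<subseteq> V - X"
      using comps_subset[OF Cc(1)] .
    define N where "N = {e \<in> M. e \<inter> C \<noteq> {}}"
    have "e \<subseteq> C" if e: "e \<in> M" "x \<in> e" "x \<in> C" for e x
    proof -
      obtain y where y: "e = {x, y}"
        using M(2)[OF e(1)] e(2) by (auto simp: card_2_iff)
      have "y \<notin> X"
        using no e y by (auto simp: insert_commute)
      then have "y \<in> V - X"
        using e(1) y M(4) by auto
      then have "y \<in> C"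
        using comps_closed[OF Cc(1) e(3)] y e(1) M(1) by blast
      then show ?thesis
        using y e by simp
    qed
    then have "\<Union>N = C"
      using sub M(4) unfolding N_def by blast
    moreover have "card (\<Union>N) = (\<Sum>e\<in>N. card e)"
    proof (rule card_Union_disjoint)
      show "pairwise disjnt N"
        using M(3) by (auto simp: N_def disjoint_def pairwise_def disjnt_def)
      show "\<And>e. e \<in> N \<Longrightarrow> finite e"
        using M(2) by (metis N_def card.infinite mem_Collect_eq zero_neq_numeral)
    qed
    moreover have "(\<Sum>e\<in>N. card e) = 2 * card N"
      using M(2) by (simp add: N_def)
    ultimately show False
      using Cc(2) by simp
  qed
  then obtain g where g: "\<And>C. C \<in> odd_comps E (V - X) \<Longrightarrow> g C \<in> X \<and> (\<exists>y\<in>C. {g C, y} \<in> M)"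
    by metis
  \<comment> \<open>Matching edges at a common vertex of \<open>X\<close> coincide, so their other
    ends do, and the two components meet.\<close>
  have "inj_on g (odd_comps E (V - X))"
  proof (rule inj_onI)
    fix C D assume CD: "C \<in> odd_comps E (V - X)" "D \<in> odd_comps E (V - X)" "g C = g D"
    then obtain y z where yz: "y \<in> C" "z \<in> D" "{g C, y} \<in> M" "{g C, z} \<in> M"
      using g by metis
    then have "{g C, y} = {g C, z}"
      using disjointD[OF M(3) yz(3,4)] by blast
    then have "y = z"
      by (auto simp: doubleton_eq_iff)
    then show "C = D"
      using CD yz comps_unique[of C E "V - X" D y] by (auto simp: odd_comps_def)
  qed
  then show ?thesis
    using g assms finite_subset by (intro card_inj_on_le[of g]) auto
qed

text \<open>Anderson's proof: for a maximal set \<open>S\<close> whose deletion leaves exactly \<open>card S\<close> odd components,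
  all components of \<open>V - S\<close> are odd and factor-critical, and Hall's theorem matches them with \<open>S\<close>.\<close>

theorem tutte:
  assumes "finite V" "\<And>X. X \<subseteq> V \<Longrightarrow> card (odd_comps E (V - X)) \<le> card X"
  shows "\<exists>M. perfect_matching E V M"
  using assms
proof (induction "card V" arbitrary: V rule: less_induct)
  case less
  note fin = less.prems(1) and tutte = less.prems(2)
  define tight where "tight S \<longleftrightarrow> S \<subseteq> V \<and> card (odd_comps E (V - S)) = card S" for S
  \<comment> \<open>The hypothesis for the empty set allows no odd component.\<close>
  have "tight {}"
    using tutte[of "{}"] by (simp add: tight_def)
  moreover have "card S < Suc (card V)" if "tight S" for S
    using that fin by (auto simp: tight_def intro: card_mono le_imp_less_Suc)
  ultimately obtain S where S: "tight S" and max: "\<And>S'. tight S' \<Longrightarrow> card S' \<le> card S"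
    using ex_has_greatest_nat[of tight "{}" card "Suc (card V)"] by (metis less_imp_le)
  have SV: "S \<subseteq> V" and oddS: "card (odd_comps E (V - S)) = card S"
    using S by (auto simp: tight_def)
  have finS: "finite S" and finVS: "finite (V - S)"
    using SV fin finite_subset by auto
  \<comment> \<open>Tutte's condition gives the weak inequality; equality would make the larger set
    \<open>S \<union> Y\<close> tight, against the choice of \<open>S\<close>.\<close>
  have not_more: "card (odd_comps E (V - S - Y)) < card S + card Y"
    if Y: "Y \<subseteq> V - S" "Y \<noteq> {}" for Y
  proof -
    have finY: "finite Y"
      using Y finVS finite_subset by blast
    have card: "card (S \<union> Y) = card S + card Y"
      using Y finY finS by (intro card_Un_disjoint) auto
    moreover have "card Y > 0"
      using Y finY by auto
    ultimately have "\<not> tight (S \<union> Y)"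
      using max[of "S \<union> Y"] by auto
    moreover have "V - (S \<union> Y) = V - S - Y" "S \<union> Y \<subseteq> V"
      using Y SV by auto
    ultimately show ?thesis
      using tutte[of "S \<union> Y"] card by (auto simp: tight_def)
  qed
  define K where "K = comps E (V - S)"
  have finK: "finite K"
    unfolding K_def by (rule finite_comps[OF finVS])
  \<comment> \<open>Deleting one vertex of an even \<open>C\<close> creates an odd component inside
    \<open>C\<close> and destroys no odd one elsewhere, against \<open>not_more\<close>.\<close>
  have odd: "odd (card C)" if C: "C \<in> K" for C
  proof
    assume ev: "even (card C)"
    have Cc: "C \<in> comps E (V - S)"
      using C by (simp add: K_def)
    obtain v where v: "v \<in> C"
      using comps_nonempty[OF Cc] by blast
    have CV: "C \<subseteq> V - S"
      using comps_subset[OF Cc] .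
    have finC: "finite C"
      using CV finVS finite_subset by blast
    have "card C \<noteq> 0"
      using v finC by auto
    then have "odd (card (C - {v}))"
      using ev v finC by simp
    then have "card (odd_comps E (C - {v})) \<noteq> 0"
      using odd_comps_parity[of "C - {v}" E] finC by (metis even_zero finite_Diff)
    moreover have "odd_comps E (V - S) - {C} = odd_comps E (V - S)"
      using ev by (auto simp: odd_comps_def)
    ultimately show False
      using card_odd_comps_refine[OF finVS Cc, of "{v}"] v CV oddS not_more[of "{v}"] by auto
  qed
  then have cardK: "card K = card S"
    using oddS by (metis (no_types, lifting) Collect_cong K_def Collect_mem_eq odd_comps_def)
  have critical: "\<exists>M. perfect_matching E (C - {v}) M" if C: "C \<in> K" and v: "v \<in> C" for C v
  proof (rule less.hyps)
    have Cc: "C \<in> comps E (V - S)"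
      using C by (simp add: K_def)
    have CV: "C \<subseteq> V - S"
      using comps_subset[OF Cc] .
    have finC: "finite C"
      using CV finVS finite_subset by blast
    show "card (C - {v}) < card V"
      using CV v fin by (intro psubset_card_mono) auto
    show fCv: "finite (C - {v})"
      using finC by simp
    fix X assume X: "X \<subseteq> C - {v}"
    show "card (odd_comps E (C - {v} - X)) \<le> card X"
    proof (rule ccontr)
      assume "\<not> ?thesis"
      \<comment> \<open>Since \<open>C - {v}\<close> has even order, a violation has excess at least
        2. This makes up for the lost component \<open>C\<close> and for the vertex
        \<open>v\<close>, against \<open>not_more\<close>.\<close>
      moreover have "even (card (odd_comps E (C - {v} - X)) + card X)"
        using odd_comps_parity_diff[OF fCv X] odd[OF C] v finC by simp
      ultimately have "card (odd_comps E (C - {v} - X)) \<ge> card X + 2"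
        by presburger
      moreover have "C - {v} - X = C - insert v X"
        by blast
      moreover have "card (insert v X) = card X + 1"
        using X finC finite_subset by (subst card_insert_disjoint) auto
      moreover have "card (odd_comps E (V - S) - {C}) = card S - 1"
        using Cc odd[OF C] oddS finVS by (simp add: odd_comps_def finite_comps)
      moreover have "card S > 0"
        using Cc odd[OF C] finVS unfolding oddS[symmetric]
        by (auto simp: card_gt_0_iff finite_comps odd_comps_def)
      moreover have "insert v X \<subseteq> C"
        using X v by blast
      moreover from this have "insert v X \<subseteq> V - S"
        using CV by blast
      ultimately show False
        using card_odd_comps_refine[OF finVS Cc, of "insert v X"] not_more[of "insert v X"]
        by simp
    qed
  qed
  define A where "A C = {s \<in> S. \<exists>v\<in>C. {v, s} \<in> E}" for C
  have "\<exists>r. inj_on r K \<and> (\<forall>C\<in>K. r C \<in> A C)"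
  proof (rule hall[OF finK])
    show "finite (A C)" for C
      using finS by (simp add: A_def)
    fix J assume J: "J \<subseteq> K"
    define N where "N = \<Union>(A ` J)"
    have NS: "N \<subseteq> S"
      by (auto simp: N_def A_def)
    have "J \<subseteq> odd_comps E (V - N)"
    \<comment> \<open>A component in \<open>J\<close> has all its outside neighbours in
      \<open>N\<close>, so it remains a component when only \<open>N\<close> is deleted. Tutte's
      condition for \<open>N\<close> thus yields Hall's condition for \<open>J\<close>.\<close>
    proof
      fix C assume C: "C \<in> J"
      then have Cc: "C \<in> comps E (V - S)"
        using J K_def by blast
      have "C \<in> comps E (V - N)"
      proof (rule comps_transfer[OF Cc])
        show "C \<subseteq> V - N"
          using comps_subset[OF Cc] NS by blast
        fix x y assume xy: "x \<in> C" "y \<in> V - N" "{x, y} \<in> E"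
        then have "y \<notin> S"
          using C by (auto simp: N_def A_def)
        then show "y \<in> C"
          using comps_closed[OF Cc xy(1)] xy by blast
      qed
      then show "C \<in> odd_comps E (V - N)"
        using odd C J by (auto simp: odd_comps_def)
    qed
    then have "card J \<le> card (odd_comps E (V - N))"
      using fin by (intro card_mono finite_odd_comps) auto
    also have "\<dots> \<le> card N"
      using tutte NS SV by blast
    finally show "card J \<le> card (\<Union>(A ` J))"
      by (simp add: N_def)
  qed
  then obtain r where r: "inj_on r K" "\<And>C. C \<in> K \<Longrightarrow> r C \<in> A C"
    by blast
  \<comment> \<open>There are as many components as elements of \<open>S\<close>, so the injective
    choice is onto.\<close>
  have rS: "r ` K = S"
    using r cardK finS by (intro card_subset_eq) (auto simp: card_image A_def)
  have "\<exists>M. perfect_matching E (insert (r C) C) M" if C: "C \<in> K" for C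
  proof -
    obtain v where v: "v \<in> C" "{v, r C} \<in> E" "r C \<in> S"
      using r(2)[OF C] by (auto simp: A_def)
    have "C \<subseteq> V - S"
      using C comps_subset unfolding K_def by blast
    moreover obtain M where "perfect_matching E (C - {v}) M"
      using critical[OF C v(1)] by blast
    ultimately have "perfect_matching E (insert v (insert (r C) (C - {v}))) (insert {v, r C} M)"
      using v by (intro perfect_matching_insert) auto
    moreover have "insert v (insert (r C) (C - {v})) = insert (r C) C"
      using v by blast
    ultimately show ?thesis
      by auto
  qed
  then obtain M where M: "\<And>C. C \<in> K \<Longrightarrow> perfect_matching E (insert (r C) C) (M C)"
    by metis
  have "disjoint_family_on (\<lambda>C. insert (r C) C) K"
    unfolding disjoint_family_on_def
  proof (intro ballI impI)
    fix C D assume CD: "C \<in> K" "D \<in> K" "C \<noteq> D"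
    have "C \<subseteq> V - S" "D \<subseteq> V - S" "r C \<in> S" "r D \<in> S" "r C \<noteq> r D" "C \<inter> D = {}"
      using CD comps_subset[of _ E "V - S"] r rS comps_unique[of C E "V - S" D]
      unfolding K_def inj_on_def by blast+
    then show "insert (r C) C \<inter> insert (r D) D = {}"
      by blast
  qed
  from perfect_matching_UN[OF M this]
  have "perfect_matching E (\<Union>C\<in>K. insert (r C) C) (\<Union>C\<in>K. M C)"
    by simp
  moreover have "(\<Union>C\<in>K. insert (r C) C) = V"
  proof -
    have "(\<Union>C\<in>K. insert (r C) C) = r ` K \<union> \<Union>K"
      by blast
    then show ?thesis
      using rS Union_comps[of E "V - S"] SV unfolding K_def by auto
  qed
  ultimately show ?case
    by metis
qed

text \<open>Components of \<open>V - X\<close> that avoid \<open>Z\<close> survive the replacement of \<open>X\<close> by \<open>X'\<close>, and the vertices of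
  \<open>I\<close> become isolated.\<close>

lemma card_odd_comps_swap:
  assumes "finite V" and X: "X' - X \<subseteq> Z"
    and Z: "\<And>x y. \<lbrakk>x \<in> X - X'; y \<in> V - X; {x, y} \<in> E\<rbrakk> \<Longrightarrow> y \<in> Z"
    and I: "I \<subseteq> V - X'" "\<And>x y. \<lbrakk>x \<in> I; y \<in> V - X'; {x, y} \<in> E\<rbrakk> \<Longrightarrow> y = x"
    and disj: "\<And>C. \<lbrakk>C \<in> comps E (V - X); C \<inter> Z = {}\<rbrakk> \<Longrightarrow> C \<inter> I = {}"
  shows "card (odd_comps E (V - X)) + card I
    \<le> card (odd_comps E (V - X')) + card {C \<in> comps E (V - X). C \<inter> Z \<noteq> {}}"
proof -
  define Q where "Q = {C \<in> comps E (V - X). C \<inter> Z \<noteq> {}}"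
  define P where "P = odd_comps E (V - X) - Q"
  have fin: "finite Q" "finite P" "finite I"
    using assms(1) I(1) finite_subset by (auto simp: Q_def P_def finite_comps finite_odd_comps)
  \<comment> \<open>The set \<open>Z\<close> contains the newly deleted vertices and the undeleted
    neighbours of the restored ones. A component avoiding \<open>Z\<close> thus neither loses
    vertices nor gains neighbours.\<close>
  have "C \<in> odd_comps E (V - X')" if C: "C \<in> P" for C
  proof -
    have Cc: "C \<in> comps E (V - X)" "C \<inter> Z = {}" "odd (card C)"
      using C by (auto simp: P_def Q_def odd_comps_def)
    have "C \<in> comps E (V - X')"
    proof (rule comps_transfer[OF Cc(1)])
      show "C \<subseteq> V - X'"
        using comps_subset[OF Cc(1)] X Cc(2) by blast
      fix x y assume xy: "x \<in> C" "y \<in> V - X'" "{x, y} \<in> E"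
      have "x \<in> V - X"
        using xy(1) comps_subset[OF Cc(1)] by blast
      then have "y \<notin> X"
        using Z[of y x] xy Cc(2) by (auto simp: insert_commute)
      then show "y \<in> C"
        using comps_closed[OF Cc(1) xy(1)] xy by blast
    qed
    then show ?thesis
      using Cc(3) by (simp add: odd_comps_def)
  qed
  moreover have "{x} \<in> odd_comps E (V - X')" if "x \<in> I" for x
  proof -
    have "{x} \<in> comps E (V - X')"
      using that I by (intro singleton_comps) auto
    then show ?thesis
      by (simp add: odd_comps_def)
  qed
  ultimately have sub: "P \<union> (\<lambda>x. {x}) ` I \<subseteq> odd_comps E (V - X')"
    by blast
  \<comment> \<open>This excludes double counting: a singleton from \<open>I\<close> is not already
    one of the surviving components.\<close>
  have "C \<inter> I = {}" if "C \<in> P" for C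
    using that disj by (auto simp: P_def Q_def odd_comps_def)
  then have "P \<inter> (\<lambda>x. {x}) ` I = {}"
    by blast
  then have "card P + card I = card (P \<union> (\<lambda>x. {x}) ` I)"
    using fin by (simp add: card_Un_disjoint card_image)
  also have "\<dots> \<le> card (odd_comps E (V - X'))"
    using sub assms(1) by (intro card_mono finite_odd_comps) auto
  finally have "card P + card I \<le> card (odd_comps E (V - X'))" .
  moreover have "card (odd_comps E (V - X)) \<le> card P + card Q"
    using fin card_mono[of "P \<union> Q" "odd_comps E (V - X)"] card_Un_le[of P Q]
    by (auto simp: P_def)
  ultimately show ?thesis
    unfolding Q_def by linarith
qed

text \<open>Components are disjoint, so points of \<open>Z\<close> chosen in different components
  differ.\<close>

lemma card_comps_meeting_le:
  assumes "finite Z"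
  shows "card {C \<in> comps E V. C \<inter> Z \<noteq> {}} \<le> card Z"
proof -
  define g where "g C = (SOME z. z \<in> C \<inter> Z)" for C
  have g: "g C \<in> C \<inter> Z" if "C \<inter> Z \<noteq> {}" for C
    using that unfolding g_def by (metis some_in_eq)
  show ?thesis
  proof (rule card_inj_on_le[of g])
    show "inj_on g {C \<in> comps E V. C \<inter> Z \<noteq> {}}"
    proof (rule inj_onI)
      fix C D assume "C \<in> {C \<in> comps E V. C \<inter> Z \<noteq> {}}" "D \<in> {C \<in> comps E V. C \<inter> Z \<noteq> {}}" "g C = g D"
      then show "C = D"
        using g[of C] g[of D] comps_unique[of C E V D "g C"] by auto
    qed
  qed (use g assms in auto)
qed

text \<open>All of \<open>Z\<close> is adjacent to \<open>t\<close> and hence lies in the component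
  of \<open>t\<close>.\<close>

lemma card_comps_meeting_le_1:
  assumes "t \<in> V" "Z \<subseteq> V" "\<And>z. z \<in> Z \<Longrightarrow> {t, z} \<in> E"
  shows "card {C \<in> comps E V. C \<inter> Z \<noteq> {}} \<le> 1"
proof -
  obtain D where D: "D \<in> comps E V" "t \<in> D"
    using assms(1) Union_comps[of E V] by blast
  have "C = D" if C: "C \<in> comps E V" "z \<in> C" "z \<in> Z" for C z
  proof -
    have "z \<in> D"
      using comps_closed[OF D] assms C by blast
    then show ?thesis
      using comps_unique[OF C(1) D(1) C(2)] by blast
  qed
  then have "{C \<in> comps E V. C \<inter> Z \<noteq> {}} \<subseteq> {D}"
    by blast
  then show ?thesis
    using card_mono[of "{D}"] by fastforce
qed

section \<open>Perfect matchings of the gadget graph\<close>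

text \<open>The bound \<open>f_le\<close> makes the truncated difference in the size of
  \<open>T_part\<close> a genuine one.\<close>

locale coloured_graph =
  fixes G :: "'v ugraph" and c :: "'v set \<Rightarrow> nat" and f :: "'v \<Rightarrow> nat"
  assumes simple: "finite_simple_graph G"
    and f_le: "v \<in> verts G \<Longrightarrow> f v \<le> colour_degree G c v"
begin

abbreviation "GV \<equiv> verts (Gcf G c f)"
abbreviation "GE \<equiv> edges (Gcf G c f)"
abbreviation "Sp \<equiv> S_part G c"
abbreviation "Tp \<equiv> T_part G c f"
abbreviation "col \<equiv> colours_at G c"

text \<open>As an image of the unordered edge, this requires no choice of an orientation.\<close>

definition lift_edge :: "'v set \<Rightarrow> 'v gvert set" where
  "lift_edge e = (\<lambda>u. SV u (c e)) ` e"

lemma edgeE: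
  assumes "e \<in> edges G"
  obtains u v where "e = {u, v}" "u \<noteq> v" "u \<in> verts G" "v \<in> verts G"
  using assms simple by (auto simp: finite_simple_graph_def card_2_iff)

lemma edge_verts: "e \<in> edges G \<Longrightarrow> u \<in> e \<Longrightarrow> u \<in> verts G"
  by (auto elim!: edgeE)

lemma finite_verts: "finite (verts G)"
  using simple by (simp add: finite_simple_graph_def)

lemma finite_edges: "finite (edges G)"
proof -
  have "edges G \<subseteq> Pow (verts G)"
    using simple by (auto simp: finite_simple_graph_def)
  then show ?thesis
    using finite_verts finite_subset by blast
qed

lemma finite_col: "finite (col u)"
  using finite_edges by (simp add: colours_at_def)

lemma SV_in_Sp [simp]: "SV v i \<in> Sp u \<longleftrightarrow> v = u \<and> i \<in> col u"
  and TV_in_Sp [simp]: "TV v i \<notin> Sp u"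
  and SV_in_Tp [simp]: "SV v i \<notin> Tp u"
  and TV_in_Tp [simp]: "TV v i \<in> Tp u \<longleftrightarrow> v = u \<and> 1 \<le> i \<and> i \<le> card (col u) - f u"
  by (auto simp: S_part_def T_part_def colour_degree_def)

lemma Sp_eq: "Sp u = SV u ` col u"
  by (auto simp: S_part_def)

lemma Tp_eq: "Tp u = TV u ` {1..card (col u) - f u}"
  by (auto simp: T_part_def colour_degree_def)

lemma card_Sp: "card (Sp u) = card (col u)" and finite_Sp: "finite (Sp u)"
  using finite_col by (auto simp: Sp_eq card_image inj_on_def)

lemma card_Tp: "card (Tp u) = card (col u) - f u" and finite_Tp: "finite (Tp u)"
  by (auto simp: Tp_eq card_image inj_on_def)

lemma GV_eq: "GV = (\<Union>u\<in>verts G. Sp u \<union> Tp u)"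
  by (simp add: Gcf_def)

lemma finite_GV: "finite GV"
  using finite_verts finite_Sp finite_Tp by (simp add: GV_eq)

lemma SV_in_GV [simp]: "SV u i \<in> GV \<longleftrightarrow> u \<in> verts G \<and> i \<in> col u"
  and TV_in_GV [simp]: "TV u i \<in> GV \<longleftrightarrow> u \<in> verts G \<and> TV u i \<in> Tp u"
  by (auto simp: GV_eq)

lemma GE_eq:
  "GE = (\<Union>u\<in>verts G. {{x, y} | x y. x \<in> Sp u \<and> y \<in> Tp u}) \<union> lift_edge ` edges G"
proof -
  have "{{SV u (c {u, v}), SV v (c {u, v})} | u v. {u, v} \<in> edges G} = lift_edge ` edges G"
  proof (intro equalityI subsetI)
    fix x assume "x \<in> lift_edge ` edges G"
    then obtain e where e: "e \<in> edges G" "x = lift_edge e"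
      by blast
    then obtain u v where "e = {u, v}"
      by (auto elim: edgeE)
    then show "x \<in> {{SV u (c {u, v}), SV v (c {u, v})} | u v. {u, v} \<in> edges G}"
      using e by (auto simp: lift_edge_def)
  qed (auto simp: lift_edge_def)
  then show ?thesis
    by (simp add: Gcf_def)
qed

lemma Sp_Tp_edge: "u \<in> verts G \<Longrightarrow> x \<in> Sp u \<Longrightarrow> y \<in> Tp u \<Longrightarrow> {x, y} \<in> GE"
  by (auto simp: GE_eq)

lemma Tp_neighbour:
  assumes "x \<in> Tp u" "{x, y} \<in> GE"
  shows "y \<in> Sp u"
proof -
  obtain i where x: "x = TV u i"
    using assms(1) by (auto simp: Tp_eq)
  show ?thesis
    using assms unfolding x GE_eq by (auto simp: lift_edge_def doubleton_eq_iff Sp_eq Tp_eq)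
qed

text \<open>Forgetting the colours recovers the original edge from its lift.\<close>

lemma lift_edge_inj: "inj lift_edge"
proof (rule injI)
  fix e e' assume eq: "lift_edge e = lift_edge e'"
  have proj: "e = (\<lambda>x. case x of SV u i \<Rightarrow> u | TV u i \<Rightarrow> u) ` lift_edge e" for e
    by (force simp: lift_edge_def image_image)
  show "e = e'"
    using proj[of e] proj[of e'] eq by simp
qed

lemma card_lift_edge: "card (lift_edge e) = card e"
  by (simp add: lift_edge_def card_image inj_on_def)

section \<open>Properly coloured factors versus perfect matchings\<close>

lemma properly_coloured_inj:
  assumes "properly_coloured c F"
  shows "inj_on c {e \<in> edges F. u \<in> e}"
  using assms unfolding properly_coloured_def inj_on_def by blast

text \<open>Lifts of the edges of \<open>F\<close> cover the vertices of \<open>Sp u\<close> with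
  used colours. As the colouring is proper, exactly \<open>card (Tp u)\<close> others are left, and
  these are matched with \<open>Tp u\<close> inside the gadget.\<close>

lemma perfect_matching_of_pc_f_factor:
  assumes "pc_f_factor G c f F"
  shows "\<exists>M. perfect_matching GE GV M"
proof -
  have F: "verts F = verts G" "edges F \<subseteq> edges G" "\<And>v. v \<in> verts G \<Longrightarrow> degree F v = f v"
    and pc: "properly_coloured c F"
    using assms by (auto simp: pc_f_factor_def f_factor_def)
  define used where "used u = c ` {e \<in> edges F. u \<in> e}" for u
  define L where "L u = SV u ` (col u - used u)" for u
  have used: "used u \<subseteq> col u" for u
    using F(2) by (auto simp: used_def colours_at_def)
  have "card (L u) = card (Tp u)" if u: "u \<in> verts G" for u
  proof -
    have "card (used u) = f u"
      using F(3)[OF u] properly_coloured_inj[OF pc] by (simp add: used_def degree_def card_image)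
    then have "card (col u - used u) = card (col u) - f u"
      using used finite_col by (metis card_Diff_subset finite_subset)
    then show ?thesis
      by (simp add: L_def card_Tp card_image inj_on_def)
  qed
  then have "\<exists>b. bij_betw b (L u) (Tp u)" if "u \<in> verts G" for u
    using that finite_col finite_Tp by (intro finite_same_card_bij) (auto simp: L_def)
  then obtain b where b: "\<And>u. u \<in> verts G \<Longrightarrow> bij_betw (b u) (L u) (Tp u)"
    by metis
  define M1 where "M1 = lift_edge ` edges F"
  define M2 where "M2 = (\<Union>u\<in>verts G. (\<lambda>x. {x, b u x}) ` L u)"
  have LS: "L u \<subseteq> Sp u" for u
    by (auto simp: L_def)
  have bT: "b u x \<in> Tp u" if "u \<in> verts G" "x \<in> L u" for u x
    using b[OF that(1)] that(2) by (auto simp: bij_betw_def)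
  have ne: "x \<noteq> y" if "x \<in> Sp u" "y \<in> Tp v" for x y u v
    using that by (auto simp: Sp_eq Tp_eq)
  have same: "u = v" if "x \<in> L u" "x \<in> L v" for x u v
    using that by (auto simp: L_def)
  have same': "u = v" if "x \<in> Tp u" "x \<in> Tp v" for x u v
    using that by (auto simp: Tp_eq)
  have "M1 \<subseteq> GE"
    using F(2) by (auto simp: M1_def GE_eq)
  moreover have "M2 \<subseteq> GE"
  proof
    fix e assume "e \<in> M2"
    then obtain u x where "u \<in> verts G" "x \<in> L u" "e = {x, b u x}"
      by (auto simp: M2_def)
    then show "e \<in> GE"
      using LS bT Sp_Tp_edge[of u x "b u x"] by blast
  qed
  moreover have "card e = 2" if "e \<in> M1" for e
    using that F(2) simple by (auto simp: M1_def card_lift_edge finite_simple_graph_def)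
  moreover have "card e = 2" if e: "e \<in> M2" for e
  proof -
    obtain u x where x: "u \<in> verts G" "x \<in> L u" "e = {x, b u x}"
      using e by (auto simp: M2_def)
    then have "x \<noteq> b u x"
      using ne LS bT by blast
    then show ?thesis
      using x(3) by simp
  qed
  moreover have "disjoint (M1 \<union> M2)"
  proof (rule disjointI)
    have 11: "e = e'" if e: "e \<in> M1" "e' \<in> M1" "e \<inter> e' \<noteq> {}" for e e'
    proof -
      obtain d d' where d: "d \<in> edges F" "e = lift_edge d" "d' \<in> edges F" "e' = lift_edge d'"
        using e by (auto simp: M1_def)
      \<comment> \<open>A common vertex of two lifts records both a common end and a common
        colour.\<close>
      then have "d \<inter> d' \<noteq> {}" "c d = c d'"
        using e(3) by (auto simp: lift_edge_def)
      then have "d = d'"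
        using pc d unfolding properly_coloured_def by blast
      then show ?thesis
        using d by simp
    qed
    have 12: "e \<inter> e' = {}" if e: "e \<in> M1" "e' \<in> M2" for e e'
    proof -
      obtain d where d: "d \<in> edges F" "e = lift_edge d"
        using e by (auto simp: M1_def)
      obtain u x where x: "u \<in> verts G" "x \<in> L u" "e' = {x, b u x}"
        using e by (auto simp: M2_def)
      have "x \<notin> e"
        using x(2) d by (auto simp: L_def lift_edge_def used_def)
      moreover have "b u x \<notin> e"
        using bT[OF x(1,2)] d by (auto simp: lift_edge_def)
      ultimately show ?thesis
        using x(3) by blast
    qed
    have 22: "e = e'" if e: "e \<in> M2" "e' \<in> M2" "e \<inter> e' \<noteq> {}" for e e'
    proof -
      obtain u x where x: "u \<in> verts G" "x \<in> L u" "e = {x, b u x}"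
        using e by (auto simp: M2_def)
      obtain v y where y: "v \<in> verts G" "y \<in> L v" "e' = {y, b v y}"
        using e by (auto simp: M2_def)
      have "x \<noteq> b v y" "y \<noteq> b u x"
        using ne LS bT x y by blast+
      then have "x = y \<or> b u x = b v y"
        using e(3) x(3) y(3) by auto
      moreover have "u = v" if "b u x = b v y"
        using same' bT[OF x(1,2)] bT[OF y(1,2)] that by metis
      ultimately show ?thesis
        using b[OF x(1)] x y same by (auto simp: bij_betw_def inj_on_def)
    qed
    fix e e' assume "e \<in> M1 \<union> M2" "e' \<in> M1 \<union> M2" "e \<noteq> e'"
    then show "e \<inter> e' = {}"
      using 11[of e e'] 12[of e e'] 12[of e' e] 22[of e e'] by blast
  qed
  moreover have "\<Union>(M1 \<union> M2) = GV"
  proof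
    have "SV u (c e) \<in> GV" if "e \<in> edges F" "u \<in> e" for u e
      using that F(2) edge_verts by (auto simp: colours_at_def)
    then have "\<Union>M1 \<subseteq> GV"
      by (auto simp: M1_def lift_edge_def)
    moreover have "\<Union>M2 \<subseteq> GV"
      using LS bT unfolding M2_def GV_eq by blast
    ultimately show "\<Union>(M1 \<union> M2) \<subseteq> GV"
      by blast
    show "GV \<subseteq> \<Union>(M1 \<union> M2)"
    proof
      fix x assume x: "x \<in> GV"
      then obtain u where u: "u \<in> verts G" "x \<in> Sp u \<union> Tp u"
        by (auto simp: GV_eq)
      consider i where "x = SV u i" "i \<in> used u" | "x \<in> L u" | "x \<in> Tp u"
        using u(2) by (auto simp: Sp_eq L_def)
      then show "x \<in> \<Union>(M1 \<union> M2)"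
      proof cases
        case 1
        then obtain e where "e \<in> edges F" "u \<in> e" "x = SV u (c e)"
          by (auto simp: used_def)
        then show ?thesis
          by (auto simp: M1_def lift_edge_def)
      next
        case 2
        then show ?thesis
          using u(1) by (auto simp: M2_def)
      next
        case 3
        then obtain y where "y \<in> L u" "x = b u y"
          using b[OF u(1)] by (auto simp: bij_betw_def)
        then show ?thesis
          using u(1) by (auto simp: M2_def)
      qed
    qed
  qed
  ultimately have "perfect_matching GE GV (M1 \<union> M2)"
    by (auto simp: perfect_matching_def)
  then show ?thesis ..
qed

text \<open>The factor consists of the edges whose lifts are matched. Two of them with a common end
  and colour would have lifts meeting in a vertex.\<close>

lemma pc_f_factor_of_perfect_matching:
  assumes "perfect_matching GE GV M"
  shows "\<exists>F. pc_f_factor G c f F"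
proof -
  have M: "M \<subseteq> GE" "disjoint M" "\<Union>M = GV" "\<And>e. e \<in> M \<Longrightarrow> card e = 2"
    using assms by (auto simp: perfect_matching_def)
  have unique: "e = e'" if "e \<in> M" "e' \<in> M" "x \<in> e" "x \<in> e'" for e e' x
    using that M(2) by (auto simp: disjoint_def)
  define F where "F = \<lparr>verts = verts G, edges = {e \<in> edges G. lift_edge e \<in> M}\<rparr>"
  have pc: "properly_coloured c F"
    unfolding properly_coloured_def
  proof (intro ballI impI notI)
    fix e e' assume e: "e \<in> edges F" "e' \<in> edges F" "e \<noteq> e' \<and> e \<inter> e' \<noteq> {}" "c e = c e'"
    then obtain u where "u \<in> e" "u \<in> e'"
      by blast
    then have "SV u (c e) \<in> lift_edge e" "SV u (c e) \<in> lift_edge e'"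
      using e(4) by (auto simp: lift_edge_def)
    then have "lift_edge e = lift_edge e'"
      using e unique by (auto simp: F_def)
    then show False
      using lift_edge_inj e(3) by (auto simp: inj_def)
  qed
  have "degree F u = f u" if u: "u \<in> verts G" for u
  proof -
    \<comment> \<open>The vertices of \<open>Sp u\<close> matched inside the gadget. Vertices of
      \<open>Tp u\<close> have no other possible partners, so \<open>P\<close> is as large as
      \<open>Tp u\<close>.\<close>
    define P where "P = {x \<in> Sp u. \<exists>t\<in>Tp u. {x, t} \<in> M}"
    have ex: "\<exists>x\<in>Sp u. {x, t} \<in> M" if t: "t \<in> Tp u" for t
    proof -
      have "t \<in> GV"
        using t u by (auto simp: GV_eq)
      then obtain e where e: "e \<in> M" "t \<in> e"
        using M(3) by blast
      then obtain x where x: "e = {t, x}"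
        using M(4)[OF e(1)] by (auto simp: card_2_iff)
      then show ?thesis
        using Tp_neighbour[OF t, of x] e M(1) insert_commute[of t x] by auto
    qed
    then obtain g where g: "\<And>t. t \<in> Tp u \<Longrightarrow> g t \<in> Sp u \<and> {g t, t} \<in> M"
      by metis
    have "bij_betw g (Tp u) P"
      unfolding bij_betw_def
    proof
      show "inj_on g (Tp u)"
      proof (rule inj_onI)
        fix t t' assume t: "t \<in> Tp u" "t' \<in> Tp u" "g t = g t'"
        then have "{g t, t} = {g t, t'}"
          using g[OF t(1)] g[OF t(2)] unique[of "{g t, t}" "{g t, t'}" "g t"] by simp
        then show "t = t'"
          by (auto simp: doubleton_eq_iff)
      qed
      show "g ` Tp u = P"
      proof (intro equalityI subsetI)
        fix x assume "x \<in> P"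
        then obtain t where t: "x \<in> Sp u" "t \<in> Tp u" "{x, t} \<in> M"
          by (auto simp: P_def)
        then have "{x, t} = {g t, t}"
          using g[OF t(2)] unique[of "{x, t}" "{g t, t}" t] by simp
        then have "x = g t"
          by (auto simp: doubleton_eq_iff)
        then show "x \<in> g ` Tp u"
          using t by blast
      qed (use g in \<open>auto simp: P_def\<close>)
    qed
    then have cardP: "card P = card (col u) - f u"
      using bij_betw_same_card card_Tp by metis
    \<comment> \<open>Every other vertex of \<open>Sp u\<close> is matched along a lift, which gives
      one vertex for each edge of \<open>F\<close> at \<open>u\<close>.\<close>
    have "Sp u - P = (\<lambda>e. SV u (c e)) ` {e \<in> edges F. u \<in> e}"
    proof (intro equalityI subsetI)
      fix x assume x: "x \<in> Sp u - P"
      then have "x \<in> GV"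
        using u by (auto simp: GV_eq)
      then obtain m where m: "m \<in> M" "x \<in> m"
        using M(3) by blast
      consider v y t where "v \<in> verts G" "y \<in> Sp v" "t \<in> Tp v" "m = {y, t}"
        | e where "e \<in> edges G" "m = lift_edge e"
        using m(1) M(1) unfolding GE_eq by blast
      then show "x \<in> (\<lambda>e. SV u (c e)) ` {e \<in> edges F. u \<in> e}"
      proof cases
        case 1
        then have "x = y" "v = u"
          using x m(2) by (auto simp: Sp_eq Tp_eq)
        then have "x \<in> P"
          using 1 m by (auto simp: P_def)
        then show ?thesis
          using x by blast
      next
        case 2
        then have "u \<in> e" "x = SV u (c e)"
          using x m(2) by (auto simp: lift_edge_def Sp_eq)
        then show ?thesis
          using 2 m(1) by (auto simp: F_def)
      qed
    next
      fix x assume "x \<in> (\<lambda>e. SV u (c e)) ` {e \<in> edges F. u \<in> e}"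
      then obtain e where e: "e \<in> edges G" "lift_edge e \<in> M" "u \<in> e" "x = SV u (c e)"
        by (auto simp: F_def)
      then have xS: "x \<in> Sp u"
        by (auto simp: colours_at_def)
      moreover have "x \<notin> P"
      proof
        assume "x \<in> P"
        then obtain t where t: "t \<in> Tp u" "{x, t} \<in> M"
          by (auto simp: P_def)
        then have "{x, t} = lift_edge e"
          using e by (intro unique[of _ _ x]) (auto simp: lift_edge_def)
        then show False
          using t(1) by (auto simp: lift_edge_def Tp_eq)
      qed
      ultimately show "x \<in> Sp u - P"
        by blast
    qed
    moreover have "inj_on (\<lambda>e. SV u (c e)) {e \<in> edges F. u \<in> e}"
      using properly_coloured_inj[OF pc, of u] by (auto simp: inj_on_def)
    ultimately have "degree F u = card (Sp u - P)"
      by (simp add: degree_def card_image)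
    also have "\<dots> = card (Sp u) - card P"
      using finite_Sp by (intro card_Diff_subset) (auto simp: P_def)
    also have "\<dots> = f u"
      using cardP card_Sp f_le[OF u] by (simp add: colour_degree_def)
    finally show ?thesis .
  qed
  then have "pc_f_factor G c f F"
    using pc by (auto simp: pc_f_factor_def f_factor_def F_def)
  then show ?thesis ..
qed

section \<open>Normalising a Tutte violator\<close>

definition violator :: "'v gvert set \<Rightarrow> bool" where
  "violator X \<longleftrightarrow> X \<subseteq> GV \<and> card X < card (odd_comps GE (GV - X))"

text \<open>The alternatives stand for membership of \<open>u\<close> in \<open>S\<close>, in
  \<open>T\<close>, and in \<open>W\<close> or none of the three. The bounds use \<open>f u\<close>
  rather than the maximum of \<open>f\<close>; the normalisation yields this stronger local
  form.\<close>

definition palette_at :: "'v gvert set \<Rightarrow> 'v \<Rightarrow> bool" where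
  "palette_at X u \<longleftrightarrow>
     Sp u \<subseteq> X \<and> Tp u \<inter> X = {} \<or>
     Tp u \<subseteq> X \<and> card (Sp u \<inter> X) + 2 \<le> f u \<or>
     Tp u \<inter> X = {} \<and> (Sp u \<inter> X = {} \<or> card (Sp u \<inter> X) + 1 \<le> f u)"

text \<open>For a vertex set of even order the excess of odd components over \<open>card X\<close>
  is even.\<close>

lemma violator_parity:
  assumes "violator X" "even (card GV)"
  shows "card X + 2 \<le> card (odd_comps GE (GV - X))"
proof -
  have "even (card (odd_comps GE (GV - X)) + card X)"
    using odd_comps_parity_diff[OF finite_GV, of X GE] assms by (simp add: violator_def)
  moreover have "card X < card (odd_comps GE (GV - X))"
    using assms(1) by (simp add: violator_def)
  moreover have "b + 2 \<le> a" if "even (a + b)" "b < a" for a b :: nat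
    using that by presburger
  ultimately show ?thesis
    by blast
qed

text \<open>Restoring \<open>Tp u\<close> affects only components meeting \<open>Sp u - X\<close>.
  If some vertex of \<open>Tp u\<close> is undeleted, there is at most one; otherwise there are at
  most \<open>card (Sp u - X)\<close>, which \<open>few\<close> bounds by
  \<open>card (Tp u) + 1\<close>. The excess of 2 absorbs the additional component.\<close>

lemma violator_remove_Tp:
  assumes X: "violator X" and ev: "even (card GV)" and u: "u \<in> verts G"
    and few: "\<not> Tp u \<subseteq> X \<or> f u \<le> card (Sp u \<inter> X) + 1"
  shows "violator (X - Tp u)"
proof -
  define n where "n = card {C \<in> comps GE (GV - X). C \<inter> (Sp u - X) \<noteq> {}}"
  have XV: "X \<subseteq> GV" and finX: "finite X"
    using X finite_GV finite_subset by (auto simp: violator_def)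
  have sub: "Sp u \<subseteq> GV" "Tp u \<subseteq> GV"
    using u by (auto simp: GV_eq)
  \<comment> \<open>Nothing is newly isolated here, so the swap lemma is used with an empty set
    \<open>I\<close>.\<close>
  have "card (odd_comps GE (GV - X)) + card ({} :: 'v gvert set)
      \<le> card (odd_comps GE (GV - (X - Tp u))) + n"
    unfolding n_def by (rule card_odd_comps_swap[OF finite_GV]) (auto dest: Tp_neighbour)
  then have odd: "card (odd_comps GE (GV - X)) \<le> card (odd_comps GE (GV - (X - Tp u))) + n"
    by simp
  have card: "card X = card (X - Tp u) + card (X \<inter> Tp u)"
    using card_Int_Diff[OF finX, of "Tp u"] by simp
  have "n \<le> card (X \<inter> Tp u) + 1"
  proof (cases "Tp u \<subseteq> X")
    case False
    then obtain t where t: "t \<in> Tp u" "t \<notin> X"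
      by blast
    have "n \<le> 1"
      unfolding n_def
    proof (rule card_comps_meeting_le_1[of t])
      show "\<And>z. z \<in> Sp u - X \<Longrightarrow> {t, z} \<in> GE"
        using Sp_Tp_edge[OF u _ t(1)] by (simp add: insert_commute)
    qed (use t sub in auto)
    then show ?thesis
      by simp
  next
    case True
    then have "X \<inter> Tp u = Tp u"
      by blast
    moreover have "n \<le> card (Sp u - X)"
      unfolding n_def using finite_Sp by (intro card_comps_meeting_le) auto
    moreover have "card (Sp u) = card (Sp u \<inter> X) + card (Sp u - X)"
      by (rule card_Int_Diff[OF finite_Sp])
    ultimately show ?thesis
      using True few card_Sp[of u] card_Tp[of u] f_le[OF u] unfolding colour_degree_def by simp
  qed
  moreover have "even (card (odd_comps GE (GV - (X - Tp u))) + card (X - Tp u))"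
    using odd_comps_parity_diff[OF finite_GV, of "X - Tp u" GE] ev XV by auto
  ultimately have "card (X - Tp u) < card (odd_comps GE (GV - (X - Tp u)))"
    using odd card violator_parity[OF X ev] by presburger
  then show ?thesis
    using XV by (auto simp: violator_def)
qed

text \<open>The undeleted part of the gadget lies in one component. Giving it up isolates all of
  \<open>Tp u\<close>, and \<open>many\<close> ensures that \<open>Tp u\<close> is at least as large
  as \<open>Sp u - X\<close>. So the new singletons pay for the new deletions, and the excess of 2
  covers the lost component.\<close>

lemma violator_add_Sp:
  assumes X: "violator X" and ev: "even (card GV)" and u: "u \<in> verts G"
    and T: "Tp u \<inter> X = {}" and S: "\<not> Sp u \<subseteq> X" and many: "f u \<le> card (Sp u \<inter> X)"
  shows "violator (X \<union> Sp u)"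
proof -
  define n where "n = card {C \<in> comps GE (GV - X). C \<inter> (Sp u - X) \<noteq> {}}"
  have XV: "X \<subseteq> GV" and finX: "finite X"
    using X finite_GV finite_subset by (auto simp: violator_def)
  have sub: "Sp u \<subseteq> GV" "Tp u \<subseteq> GV"
    using u by (auto simp: GV_eq)
  have edge: "{t, z} \<in> GE" if "t \<in> Tp u" "z \<in> Sp u" for t z
    using Sp_Tp_edge[OF u that(2,1)] by (simp add: insert_commute)
  have ST: "Sp u \<inter> Tp u = {}"
    by (auto simp: Sp_eq Tp_eq)
  have odd: "card (odd_comps GE (GV - X)) + card (Tp u)
      \<le> card (odd_comps GE (GV - (X \<union> Sp u))) + n"
    unfolding n_def
  proof (rule card_odd_comps_swap[OF finite_GV])
    show "Tp u \<subseteq> GV - (X \<union> Sp u)"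
      using sub T ST by blast
    show "y = x" if "x \<in> Tp u" "y \<in> GV - (X \<union> Sp u)" "{x, y} \<in> GE" for x y
      using that Tp_neighbour by blast
    fix C assume C: "C \<in> comps GE (GV - X)" "C \<inter> (Sp u - X) = {}"
    \<comment> \<open>An undeleted \<open>z\<close> in \<open>Sp u\<close> is adjacent to all of
      \<open>Tp u\<close>, so a component containing a vertex of \<open>Tp u\<close> also contains
      \<open>z\<close> and is not among the survivors.\<close>
    obtain z where z: "z \<in> Sp u - X"
      using S by blast
    have "z \<in> C" if "t \<in> C" "t \<in> Tp u" for t
      using comps_closed[OF C(1) that(1), of z] edge[of t z] z sub that by blast
    then show "C \<inter> Tp u = {}"
      using z C(2) by blast
  qed auto
  have card_S: "card (Sp u) = card (Sp u \<inter> X) + card (Sp u - X)"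
    by (rule card_Int_Diff[OF finite_Sp])
  have "card (Sp u - X) > 0"
    using S finite_Sp by (auto simp: card_gt_0_iff)
  \<comment> \<open>As \<open>Sp u\<close> is not exhausted, \<open>many\<close> forces
    \<open>f u\<close> strictly below the colour degree.\<close>
  then have "card (Tp u) > 0"
    using card_S many card_Sp[of u] card_Tp[of u] by simp
  then obtain t where t: "t \<in> Tp u"
    by (auto simp: card_gt_0_iff)
  have "n \<le> 1"
    unfolding n_def by (rule card_comps_meeting_le_1[of t]) (use t sub T edge in auto)
  moreover have "card (X \<union> Sp u) = card X + card (Sp u - X)"
  proof -
    have "X \<union> Sp u = X \<union> (Sp u - X)"
      by blast
    then show ?thesis
      using finX finite_Sp[of u] card_Un_disjoint[of X "Sp u - X"] by auto
  qed
  ultimately have "card (X \<union> Sp u) < card (odd_comps GE (GV - (X \<union> Sp u)))"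
    using odd card_S many violator_parity[OF X ev] card_Sp[of u] card_Tp[of u] by simp
  then show ?thesis
    using XV sub by (auto simp: violator_def)
qed

text \<open>Leaving \<open>X\<close> unchanged outside the gadget of \<open>u\<close> lets the
  vertices be treated one after another.\<close>

lemma violator_normalise_at:
  assumes X: "violator X" and ev: "even (card GV)" and u: "u \<in> verts G"
  shows "\<exists>X'. violator X' \<and> X' - (Sp u \<union> Tp u) = X - (Sp u \<union> Tp u) \<and> palette_at X' u"
proof (cases "Tp u \<subseteq> X \<and> card (Sp u \<inter> X) + 2 \<le> f u")
  case True
  then show ?thesis
    using X by (auto simp: palette_at_def)
next
  case False
  define Y where "Y = X - Tp u"
  have Y: "violator Y"
    using violator_remove_Tp[OF X ev u] False by (auto simp: Y_def)
  have T: "Tp u \<inter> Y = {}"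
    by (auto simp: Y_def)
  show ?thesis
  proof (cases "palette_at Y u")
    case True
    then show ?thesis
      using Y by (intro exI[of _ Y]) (auto simp: Y_def)
  next
    case False
    \<comment> \<open>Since \<open>Tp u\<close> misses \<open>Y\<close>, failure of the first and
      third alternatives supplies the hypotheses of \<open>violator_add_Sp\<close>.\<close>
    then have "\<not> Sp u \<subseteq> Y" "f u \<le> card (Sp u \<inter> Y)"
      using T by (auto simp: palette_at_def)
    then have "violator (Y \<union> Sp u)"
      using violator_add_Sp[OF Y ev u T] by blast
    moreover have "palette_at (Y \<union> Sp u) u"
      using T by (auto simp: palette_at_def Sp_eq Tp_eq)
    ultimately show ?thesis
      by (intro exI[of _ "Y \<union> Sp u"]) (auto simp: Y_def)
  qed
qed

lemma violator_normalise:
  assumes X: "violator X"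
  shows "\<exists>X'. violator X' \<and> (\<forall>u\<in>verts G. palette_at X' u)"
proof (cases "even (card GV)")
  case False
  \<comment> \<open>An odd number of odd components is at least one, which exceeds the cardinality
    of the empty set.\<close>
  then have "odd (card (odd_comps GE (GV - {})))"
    using odd_comps_parity[OF finite_GV, of GE] by simp
  then have "violator {}"
    by (auto simp: violator_def intro: Nat.gr0I)
  then show ?thesis
    by (intro exI[of _ "{}"]) (auto simp: palette_at_def)
next
  case True
  have "\<exists>X'. violator X' \<and> (\<forall>u\<in>U. palette_at X' u)" if "finite U" "U \<subseteq> verts G" for U
    using that
  proof (induction U rule: finite_induct)
    case empty
    then show ?case
      using X by blast
  next
    case (insert u U)
    then obtain Y where Y: "violator Y" "\<And>v. v \<in> U \<Longrightarrow> palette_at Y v"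
      by auto
    have u: "u \<in> verts G"
      using insert by simp
    obtain X' where X': "violator X'" "X' - (Sp u \<union> Tp u) = Y - (Sp u \<union> Tp u)" "palette_at X' u"
      using violator_normalise_at[OF Y(1) True u] by blast
    have "palette_at X' v" if v: "v \<in> U" for v
    proof -
      have "v \<noteq> u"
        using v insert by blast
      \<comment> \<open>Gadgets of different vertices are disjoint, so the form reached at earlier
        vertices persists.\<close>
      then have disj: "(Sp v \<union> Tp v) \<inter> (Sp u \<union> Tp u) = {}"
        by (auto simp: Sp_eq Tp_eq)
      have "x \<in> X' \<longleftrightarrow> x \<in> Y" if "x \<in> Sp v \<union> Tp v" for x
        using that disj X'(2) by blast
      then have "Sp v \<inter> X' = Sp v \<inter> Y" "Tp v \<inter> X' = Tp v \<inter> Y"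
          "Sp v \<subseteq> X' \<longleftrightarrow> Sp v \<subseteq> Y" "Tp v \<subseteq> X' \<longleftrightarrow> Tp v \<subseteq> Y"
        by blast+
      then show ?thesis
        using Y(2)[OF v] by (simp only: palette_at_def)
    qed
    then show ?case
      using X' by auto
  qed
  then show ?thesis
    using finite_verts by blast
qed

section \<open>From normalised sets to palette systems\<close>

lemma palette_system_of_palette_at:
  assumes X: "X \<subseteq> GV" and pal: "\<And>u. u \<in> verts G \<Longrightarrow> palette_at X u"
    and k: "c ` edges G \<subseteq> {1..k}"
  shows "\<exists>S T W. palette_system G k f S T W \<and> X_palette G k c f S T W = X"
proof -
  \<comment> \<open>The colours recorded by \<open>X\<close> at \<open>u\<close>; this set serves as
    the index of \<open>u\<close> in the families \<open>T\<close> and \<open>W\<close>.\<close>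
  define A where "A u = {i. SV u i \<in> X}" for u
  have A: "A u \<subseteq> col u" "A u \<subseteq> {1..k}" "Sp u \<inter> X = SV u ` A u" "card (Sp u \<inter> X) = card (A u)" for u
  proof -
    show 1: "A u \<subseteq> col u"
      using X by (auto simp: A_def)
    have "col u \<subseteq> c ` edges G"
      by (auto simp: colours_at_def)
    then show "A u \<subseteq> {1..k}"
      using 1 k by blast
    show 2: "Sp u \<inter> X = SV u ` A u"
      using 1 by (auto simp: Sp_eq A_def)
    then show "card (Sp u \<inter> X) = card (A u)"
      by (simp add: card_image inj_on_def)
  qed
  \<comment> \<open>The alternatives of \<open>palette_at\<close> can overlap, for instance when
    \<open>Tp u\<close> is empty. Letting each type exclude the earlier ones makes the palette
    system disjoint. The condition that \<open>A u\<close> is nonempty in \<open>typeW\<close>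
    matches the lower bound 1 in \<open>C1\<close>.\<close>
  define typeS where "typeS u \<longleftrightarrow> Sp u \<subseteq> X \<and> Tp u \<inter> X = {}" for u
  define typeT where "typeT u \<longleftrightarrow> \<not> typeS u \<and> Tp u \<subseteq> X \<and> card (A u) + 2 \<le> f u" for u
  define typeW where
    "typeW u \<longleftrightarrow> \<not> typeS u \<and> \<not> typeT u \<and> Tp u \<inter> X = {} \<and> A u \<noteq> {} \<and> card (A u) + 1 \<le> f u" for u
  define S where "S = {u \<in> verts G. typeS u}"
  define T where "T B = {u \<in> verts G. typeT u \<and> A u = B}" for B
  define W where "W B = {u \<in> verts G. typeW u \<and> A u = B}" for B
  \<comment> \<open>This turns the local bounds into those defining \<open>C0\<close> and
    \<open>C1\<close>.\<close>
  have f_max: "f u \<le> f_max G f" if "u \<in> verts G" for u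
    using that finite_verts by (simp add: f_max_def)
  have C0: "A u \<in> C0 G k f" if "u \<in> verts G" "typeT u" for u
    using that f_max[OF that(1)] A(2)[of u] by (simp add: C0_def typeT_def)
  have C1: "A u \<in> C1 G k f" if "u \<in> verts G" "typeW u" for u
  proof -
    have "finite (A u)"
      using A(2)[of u] finite_subset by blast
    then have "card (A u) > 0"
      using that by (simp add: typeW_def card_gt_0_iff)
    then show ?thesis
      using that f_max[OF that(1)] A(2)[of u] by (simp add: C1_def typeW_def)
  qed
  have UT: "(\<Union>B\<in>C0 G k f. T B) = {u \<in> verts G. typeT u}"
    using C0 by (auto simp: T_def)
  have UW: "(\<Union>B\<in>C1 G k f. W B) = {u \<in> verts G. typeW u}"
    using C1 by (auto simp: W_def)
  have "palette_system G k f S T W"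
    unfolding palette_system_def UT UW
    by (auto simp: S_def T_def W_def disjoint_family_on_def typeT_def typeW_def)
  moreover have "X_palette G k c f S T W = X"
  proof -
    have XS: "X_S G c S = (\<Union>u\<in>{u \<in> verts G. typeS u}. Sp u)"
      by (simp add: X_S_def S_def)
    have set: "{SV u i | i. i \<in> A u \<inter> col u} = Sp u \<inter> X" for u
      using A(1,3) by auto
    have XT: "X_T G k c f T = (\<Union>u\<in>{u \<in> verts G. typeT u}. Tp u \<union> (Sp u \<inter> X))"
    proof -
      \<comment> \<open>Members of \<open>T B\<close> have index \<open>B\<close>, so
        \<open>B\<close> can be replaced by \<open>A u\<close>.\<close>
      have "X_T G k c f T = (\<Union>u\<in>(\<Union>B\<in>C0 G k f. T B). Tp u \<union> {SV u i | i. i \<in> A u \<inter> col u})"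
        unfolding X_T_def T_def by blast
      then show ?thesis
        by (simp only: set UT)
    qed
    have XW: "X_W G k c f W = (\<Union>u\<in>{u \<in> verts G. typeW u}. Sp u \<inter> X)"
    proof -
      have "X_W G k c f W = (\<Union>u\<in>(\<Union>B\<in>C1 G k f. W B). {SV u i | i. i \<in> A u \<inter> col u})"
        unfolding X_W_def W_def by blast
      then show ?thesis
        by (simp only: set UW)
    qed
    show ?thesis
      unfolding X_palette_def XS XT XW
    proof (intro equalityI subsetI)
      fix x assume x: "x \<in> X"
      then obtain u where u: "u \<in> verts G" "x \<in> Sp u \<union> Tp u"
        using X by (auto simp: GV_eq)
      \<comment> \<open>If \<open>u\<close> had no type, its gadget would miss \<open>X\<close>; in
        types S and W the vertex \<open>x\<close> cannot lie in \<open>Tp u\<close>.\<close>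
      have "typeS u \<and> x \<in> Sp u \<or> typeT u \<or> typeW u \<and> x \<in> Sp u"
        using pal[OF u(1)] u(2) x A(3)[of u]
        unfolding palette_at_def A(4) typeS_def typeT_def typeW_def by blast
      then show "x \<in> (\<Union>u\<in>{u \<in> verts G. typeS u}. Sp u) \<union>
          (\<Union>u\<in>{u \<in> verts G. typeT u}. Tp u \<union> (Sp u \<inter> X)) \<union>
          (\<Union>u\<in>{u \<in> verts G. typeW u}. Sp u \<inter> X)"
        using u x by blast
    qed (auto simp: typeS_def typeT_def)
  qed
  ultimately show ?thesis
    by blast
qed

text \<open>Brings palette sets under \<open>perfect_matching_imp_odd_comps_le\<close>.\<close>

lemma X_palette_subset:
  assumes "palette_system G k f S T W"
  shows "X_palette G k c f S T W \<subseteq> GV"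
proof -
  have "S \<subseteq> verts G" "\<And>A. A \<in> C0 G k f \<Longrightarrow> T A \<subseteq> verts G" "\<And>A. A \<in> C1 G k f \<Longrightarrow> W A \<subseteq> verts G"
    using assms by (auto simp: palette_system_def)
  then have "X_S G c S \<subseteq> GV" "X_T G k c f T \<subseteq> GV" "X_W G k c f W \<subseteq> GV"
    unfolding X_S_def X_T_def X_W_def GV_eq S_part_def by blast+
  then show ?thesis
    by (simp add: X_palette_def)
qed

end

theorem theorem1p4:
  fixes G :: "'v ugraph" and k :: nat and c :: "'v set \<Rightarrow> nat" and f :: "'v \<Rightarrow> nat"
  assumes "finite_simple_graph G"
    and "c ` edges G \<subseteq> {1..k}"
    and "\<forall>v\<in>verts G. f v \<le> colour_degree G c v"
  shows "(\<exists>F. pc_f_factor G c f F) \<longleftrightarrow>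
    (\<forall>S T W. palette_system G k f S T W \<longrightarrow>
       odd_components (delete_verts (Gcf G c f) (X_palette G k c f S T W))
         \<le> card (X_palette G k c f S T W))"
proof -
  interpret coloured_graph G c f
    using assms by unfold_locales auto
  show ?thesis
    unfolding odd_components_delete_verts
  proof (intro iffI allI impI)
    fix S T W
    assume "\<exists>F. pc_f_factor G c f F" and ps: "palette_system G k f S T W"
    then obtain M where "perfect_matching GE GV M"
      using perfect_matching_of_pc_f_factor by blast
    then show "card (odd_comps GE (GV - X_palette G k c f S T W)) \<le> card (X_palette G k c f S T W)"
      using perfect_matching_imp_odd_comps_le[OF finite_GV X_palette_subset[OF ps]] by blast
  next
    assume pal: "\<forall>S T W. palette_system G k f S T W \<longrightarrow>
      card (odd_comps GE (GV - X_palette G k c f S T W)) \<le> card (X_palette G k c f S T W)"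
    \<comment> \<open>A set violating Tutte's condition would normalise to the set of a palette
      system, against \<open>pal\<close>.\<close>
    have "\<exists>M. perfect_matching GE GV M"
    proof (rule tutte[OF finite_GV], rule ccontr)
      fix X assume "X \<subseteq> GV" "\<not> card (odd_comps GE (GV - X)) \<le> card X"
      then have "violator X"
        by (simp add: violator_def)
      then obtain X' where X': "violator X'" "\<forall>u\<in>verts G. palette_at X' u"
        using violator_normalise by blast
      then obtain S T W where "palette_system G k f S T W" "X_palette G k c f S T W = X'"
        using palette_system_of_palette_at[of X' k] assms(2) by (auto simp: violator_def)
      then show False
        using X'(1) pal by (auto simp: violator_def not_le[symmetric])
    qed
    then show "\<exists>F. pc_f_factor G c f F"
      using pc_f_factor_of_perfect_matching by blast
  qed
qed

end
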